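(* Let $p\in[1,+\infty)$, and let $E$ be a Banach space when $p=1$, and a normed space when $p>1$. Let $Y\in\{c(E),l^\infty(E)\}$, let $f\colon E\to E$, and suppose that the composition operator $C_f$ maps $bv_p(E)$ into $Y$. Then $C_f\colon bv_p(E)\to Y$ is locally compact if and only if $f$ is a constant map.
   Context: $E$ is over $\mathbb R$ or $\mathbb C$ with norm $\|\cdot\|$. For a map $f\colon E\to E$, the composition operator $C_f$ assigns to a sequence $x\colon\mathbb N\to E$ the sequence $C_f(x)$ with $C_f(x)(n)=f(x(n))$ for all $n\in\mathbb N$. $l^\infty(E)$ is the space of bounded $E$-valued sequences and $c(E)$ its subspace of convergent sequences, both with norm $\|x\|_\infty=\sup_n\|x(n)\|$. $bv_p(E)$ is the space of all sequences $x\colon\mathbb N\to E$ with $\sum_{n=1}^\infty\|x(n+1)-x(n)\|^p<+\infty$, with norm $\|x\|_{bv_p}=\|x(1)\|+\bigl(\sum_{n=1}^\infty\|x(n+1)-x(n)\|^p\bigr)^{1/p}$. A (not necessarily linear or continuous) map $F\colon X\to Y$ between normed spaces is locally compact if for every bounded subset $B$ of $X$ the image $F(B)$ is contained in a compact subset of $Y$. *)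

theory Defs
  imports "HOL-Analysis.Analysis"
begin

text \<open>
  Sequences are functions on \<^typ>\<open>nat\<close>, so the first term of a sequence \<open>x\<close> is \<open>x 0\<close>.
  The scalars play no role below: a complex normed space is treated as a real one by
  restriction of scalars.
\<close>

definition comp_op :: "('a \<Rightarrow> 'a) \<Rightarrow> (nat \<Rightarrow> 'a) \<Rightarrow> (nat \<Rightarrow> 'a)"
  where "comp_op f x = (\<lambda>n. f (x n))"

definition linf_space :: "(nat \<Rightarrow> 'a::real_normed_vector) set"
  where "linf_space = {x. bounded (range x)}"

definition c_space :: "(nat \<Rightarrow> 'a::real_normed_vector) set"
  where "c_space = {x. convergent x}"

text \<open>
  Off \<open>linf_space\<close> the supremum is unspecified (possibly negative), and
  \<^locale>\<open>Metric_space\<close> asks for symmetry and nonnegativity of the distance on the whole type;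
  hence the default value 0 there.
\<close>

definition sup_norm :: "(nat \<Rightarrow> 'a::real_normed_vector) \<Rightarrow> real"
  where "sup_norm x = (if x \<in> linf_space then SUP n. norm (x n) else 0)"

definition bv_space :: "real \<Rightarrow> (nat \<Rightarrow> 'a::real_normed_vector) set"
  where "bv_space p = {x. summable (\<lambda>n. norm (x (Suc n) - x n) powr p)}"

definition bv_norm :: "real \<Rightarrow> (nat \<Rightarrow> 'a::real_normed_vector) \<Rightarrow> real"
  where "bv_norm p x =
    norm (x 0) + (\<Sum>n. norm (x (Suc n) - x n) powr p) powr (1 / p)"

text \<open>
  A normed space is given by its carrier and its norm; its topology is that of the metric
  \<open>N (x - y)\<close>. The condition \<open>compactin\<close> includes that the compact set lies in the carrier of
  the target space.
\<close>

definition locally_compact_map ::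
  "'x set \<Rightarrow> ('x \<Rightarrow> real) \<Rightarrow> 'y::minus set \<Rightarrow> ('y \<Rightarrow> real) \<Rightarrow> ('x \<Rightarrow> 'y) \<Rightarrow> bool"
  where "locally_compact_map X NX Y NY F \<longleftrightarrow>
    F \<in> X \<rightarrow> Y \<and>
    (\<forall>B. B \<subseteq> X \<and> (\<exists>M. \<forall>x\<in>B. NX x \<le> M) \<longrightarrow>
      (\<exists>K. compactin (Metric_space.mtopology Y (\<lambda>x y. NY (x - y))) K \<and> F ` B \<subseteq> K))"

lemma c_space_subset_linf_space: "c_space \<subseteq> linf_space"
  unfolding c_space_def linf_space_def
  by (auto simp: convergent_def intro: convergent_imp_bounded)

lemma norm_le_sup_norm:
  assumes "x \<in> linf_space"
  shows "norm (x n) \<le> sup_norm x"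
proof -
  have "bdd_above (range (\<lambda>n. norm (x n)))"
    using assms by (auto simp: linf_space_def bounded_iff bdd_above_def)
  then have "norm (x n) \<le> (SUP n. norm (x n))"
    by (rule cSUP_upper2) auto
  then show ?thesis
    using assms by (simp add: sup_norm_def)
qed

lemma sup_norm_nonneg: "0 \<le> sup_norm x"
proof (cases "x \<in> linf_space")
  case True
  have "0 \<le> norm (x 0)" by simp
  also have "\<dots> \<le> sup_norm x" using True by (rule norm_le_sup_norm)
  finally show ?thesis .
qed (simp add: sup_norm_def)

lemma sup_norm_le:
  assumes "\<And>n. norm (x n) \<le> b"
  shows "sup_norm x \<le> b"
proof -
  have "0 \<le> norm (x 0)" by simp
  also have "\<dots> \<le> b" by (rule assms)
  finally have "0 \<le> b" .
  moreover have "(SUP n. norm (x n)) \<le> b"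
    by (rule cSUP_least) (auto intro: assms)
  ultimately show ?thesis
    by (simp add: sup_norm_def)
qed

lemma diff_in_linf_space:
  assumes "x \<in> linf_space" "y \<in> linf_space"
  shows "x - y \<in> linf_space"
proof -
  have "bounded ((\<lambda>n. x n - y n) ` UNIV)"
    using assms by (intro bounded_minus_comp) (auto simp: linf_space_def)
  then show ?thesis
    by (simp add: linf_space_def fun_diff_def)
qed

lemma sup_norm_minus_commute: "sup_norm (x - y) = sup_norm (y - x)"
proof -
  have "norm ((x - y) n) = norm ((y - x) n)" for n
    by (simp add: norm_minus_commute)
  then show ?thesis
    by (simp only: sup_norm_def linf_space_def mem_Collect_eq bounded_iff ball_simps)
qed

lemma Metric_space_linf: "Metric_space linf_space (\<lambda>x y. sup_norm (x - y))"
proof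
  fix x y z :: "nat \<Rightarrow> 'a"
  show "0 \<le> sup_norm (x - y)" by (rule sup_norm_nonneg)
  show "sup_norm (x - y) = sup_norm (y - x)" by (rule sup_norm_minus_commute)
  assume x: "x \<in> linf_space" and y: "y \<in> linf_space"
  show "sup_norm (x - y) = 0 \<longleftrightarrow> x = y"
  proof
    assume 0: "sup_norm (x - y) = 0"
    have "norm ((x - y) n) \<le> 0" for n
      using norm_le_sup_norm[OF diff_in_linf_space[OF x y], of n] 0 by simp
    then show "x = y" by (auto simp: fun_eq_iff)
  next
    assume "x = y"
    then show "sup_norm (x - y) = 0"
      using sup_norm_le[of "x - y" 0] sup_norm_nonneg[of "x - y"] by simp
  qed
  assume z: "z \<in> linf_space"
  show "sup_norm (x - z) \<le> sup_norm (x - y) + sup_norm (y - z)"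
  proof (rule sup_norm_le)
    fix n
    have "norm ((x - z) n) \<le> norm ((x - y) n) + norm ((y - z) n)"
      using norm_triangle_ineq[of "x n - y n" "y n - z n"] by simp
    also have "\<dots> \<le> sup_norm (x - y) + sup_norm (y - z)"
      by (intro add_mono norm_le_sup_norm diff_in_linf_space x y z)
    finally show "norm ((x - z) n) \<le> sup_norm (x - y) + sup_norm (y - z)" .
  qed
qed

lemma Metric_space_c: "Metric_space c_space (\<lambda>x y. sup_norm (x - y))"
  using Metric_space.subspace[OF Metric_space_linf c_space_subset_linf_space] .

end

theory Submission imports Defs begin

text \<open>
  If \<open>f a \<noteq> f b\<close>, the sequences that are \<open>b\<close> at a single index and \<open>a\<close> elsewhere are bounded in
  \<open>bv_p\<close>, while their images under the composition operator have pairwise distance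
  at least \<open>\<parallel>f b - f a\<parallel>\<close> and so have no Cauchy subsequence.
\<close>

text \<open>In a compact set some subsequence of \<open>\<sigma>\<close> would converge and hence be
  Cauchy, yet its terms have distinct indices and stay at distance at least
  \<open>e\<close>.\<close>

lemma Metric_space_no_compactin_separated:
  assumes "Metric_space M d" "e > 0"
    and sep: "\<And>i j :: nat. i \<noteq> j \<Longrightarrow> e \<le> d (\<sigma> i) (\<sigma> j)"
    and K: "compactin (Metric_space.mtopology M d) K"
  shows "\<not> range \<sigma> \<subseteq> K"
proof
  interpret Metric_space M d by fact
  assume sub: "range \<sigma> \<subseteq> K"
  then obtain l r where r: "strict_mono (r :: nat \<Rightarrow> nat)"
    and lim: "limitin mtopology (\<sigma> \<circ> r) l sequentially"
    using K unfolding compactin_sequentially by blast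
  have "K \<subseteq> M"
    using K compactin_subset_topspace by fastforce
  with sub have "range (\<sigma> \<circ> r) \<subseteq> M"
    by auto
  with lim have "MCauchy (\<sigma> \<circ> r)"
    using convergent_imp_MCauchy by blast
  then obtain N where N: "\<And>n n'. \<lbrakk>N \<le> n; N \<le> n'\<rbrakk> \<Longrightarrow> d ((\<sigma> \<circ> r) n) ((\<sigma> \<circ> r) n') < e"
    using \<open>e > 0\<close> unfolding MCauchy_def by blast
  have "r N \<noteq> r (Suc N)"
    using strict_monoD[OF r, of N "Suc N"] by simp
  then show False
    using sep[of "r N" "r (Suc N)"] N[of N "Suc N"] by simp
qed

text \<open>Only the jump up to \<open>b\<close> and the jump back to \<open>a\<close> contribute,
  so the sum does not depend on the position of the spike.\<close>

lemma sums_bv_spike: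
  fixes a b :: "'a::real_normed_vector"
  defines "x \<equiv> \<lambda>k. (\<lambda>_. a)(Suc k := b)"
  shows "(\<lambda>n. norm (x k (Suc n) - x k n) powr p) sums (2 * norm (b - a) powr p)"
proof -
  have "(\<lambda>n. if n \<in> {k, Suc k} then norm (b - a) powr p else 0)
      sums (\<Sum>n\<in>{k, Suc k}. norm (b - a) powr p)"
    by (rule sums_If_finite_set) simp
  \<comment> \<open>Away from the two jumps the difference vanishes, and \<open>0 powr p\<close> is
    0 for every real \<open>p\<close>.\<close>
  moreover have "norm (x k (Suc n) - x k n) powr p
      = (if n \<in> {k, Suc k} then norm (b - a) powr p else 0)" for n
    by (auto simp: x_def norm_minus_commute)
  ultimately show ?thesis
    by simp
qed

theorem theorem40:
  fixes p :: real
    and f :: "'a::real_normed_vector \<Rightarrow> 'a"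
    and Y :: "(nat \<Rightarrow> 'a) set"
  assumes "1 \<le> p"
    and "p = 1 \<Longrightarrow> complete (UNIV :: 'a set)"
    and "Y \<in> {c_space, linf_space}"
    and "comp_op f \<in> bv_space p \<rightarrow> Y"
  shows "locally_compact_map (bv_space p) (bv_norm p) Y sup_norm (comp_op f)
    \<longleftrightarrow> f constant_on UNIV"
proof
  \<comment> \<open>After this fact and the next, the two choices of \<open>Y\<close> need no
    further distinction.\<close>
  have MY: "Metric_space Y (\<lambda>x y. sup_norm (x - y))"
    using assms(3) Metric_space_linf Metric_space_c by auto
  have Y: "Y \<subseteq> linf_space"
    using assms(3) c_space_subset_linf_space by auto
  show "f constant_on UNIV"
    if lc: "locally_compact_map (bv_space p) (bv_norm p) Y sup_norm (comp_op f)"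
  proof (rule ccontr)
    assume "\<not> f constant_on UNIV"
    then obtain a b where ab: "f a \<noteq> f b"
      unfolding constant_on_def by metis
    \<comment> \<open>The spike avoids index 0, so every \<open>x k\<close> starts at
      \<open>a\<close> and has two jumps; all \<open>bv_norm p (x k)\<close> are then equal.\<close>
    define x where "x \<equiv> \<lambda>k. (\<lambda>_. a)(Suc k := b)"
    have sums: "(\<lambda>n. norm (x k (Suc n) - x k n) powr p) sums (2 * norm (b - a) powr p)" for k
      unfolding x_def by (rule sums_bv_spike)
    have x_bv: "range x \<subseteq> bv_space p"
      using sums by (auto simp: bv_space_def sums_iff)
    have "bv_norm p (x k) = norm a + (2 * norm (b - a) powr p) powr (1 / p)" for k
      using sums_unique[OF sums[of k]] by (simp add: bv_norm_def x_def)
    then have "\<exists>M. \<forall>y\<in>range x. bv_norm p y \<le> M"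
      by auto
    with lc x_bv obtain K
      where K: "compactin (Metric_space.mtopology Y (\<lambda>x y. sup_norm (x - y))) K"
        and sub: "comp_op f ` range x \<subseteq> K"
      unfolding locally_compact_map_def by blast
    have in_linf: "comp_op f (x k) \<in> linf_space" for k
      using assms(4) x_bv Y by blast
    have sep: "norm (f b - f a) \<le> sup_norm (comp_op f (x i) - comp_op f (x j))"
      if "i \<noteq> j" for i j
      \<comment> \<open>At index \<open>Suc i\<close> the sequence \<open>x i\<close> has its spike
        \<open>b\<close>, while \<open>x j\<close> still has the value \<open>a\<close>.\<close>
      using norm_le_sup_norm[OF diff_in_linf_space[OF in_linf in_linf], of i j "Suc i"] that
      by (simp add: comp_op_def x_def)
    have "\<not> range (\<lambda>k. comp_op f (x k)) \<subseteq> K"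
      using ab by (intro Metric_space_no_compactin_separated[OF MY _ sep K]) auto
    with sub show False
      by blast
  qed
  show "locally_compact_map (bv_space p) (bv_norm p) Y sup_norm (comp_op f)"
    if const: "f constant_on UNIV"
  proof -
    interpret Metric_space Y "\<lambda>x y. sup_norm (x - y)" by (rule MY)
    obtain c where c: "\<And>x. f x = c"
      using const by (auto simp: constant_on_def)
    \<comment> \<open>The zero sequence serves as a point of the domain: its image is the constant
      sequence \<open>c\<close>, which therefore lies in \<open>Y\<close>.\<close>
    have "(\<lambda>_. 0) \<in> bv_space p"
      by (simp add: bv_space_def)
    with assms(4) have "(\<lambda>_. c) \<in> Y"
      by (auto simp: comp_op_def c)
    then have "compactin mtopology {\<lambda>_. c}"
      by (simp add: compactin_sing)
    moreover have "comp_op f ` B \<subseteq> {\<lambda>_. c}" for B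
      by (auto simp: comp_op_def c)
    ultimately show ?thesis
      unfolding locally_compact_map_def using assms(4) by blast
  qed
qed

end
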